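(* Let $G$ be a group with a non-orientable lineal action on a hyperbolic space $X$, with limit points $\xi_+,\xi_-\in\partial X$. Define $\varepsilon:G\to\{\pm1\}$ by $\varepsilon(g)=-1$ if $g$ swaps $\xi_+$ and $\xi_-$, and $\varepsilon(g)=1$ otherwise. Let $K$ be the kernel of $\varepsilon$. Then the Busemann quasimorphism $\beta_{\xi_+}:K\to\mathbb{R}$ extends to an $\varepsilon$-quasicocycle $\varphi$ on $G$ of defect at most $2D(\beta_{\xi_+})$. In particular, $\varphi$ is an $\varepsilon$-cocycle if and only if the action of $K$ on $X$ is regular.
   Context: A hyperbolic space is a geodesic Gromov hyperbolic metric space (not necessarily proper) with Gromov boundary $\partial X$; actions are by isometries. The limit set $\Lambda(G)\subset\partial X$ is the set of accumulation points in $\partial X$ of a $G$-orbit. An action is lineal if $|\Lambda(G)|=2$ (equivalently, $G$ contains a loxodromic element and any two loxodromic elements have the same limit points); a lineal action is orientable if no element of $G$ swaps the two limit points, and non-orientable otherwise. A quasimorphism on a group $K$ is a map $q:K\to\mathbb{R}$ whose defect $D(q)=\sup_{g,h}|q(gh)-q(g)-q(h)|$ is finite; its homogenization is $g\mapsto\lim_{n\to\infty}q(g^n)/n$. If $K$ acts on $X$ fixing $\xi\in\partial X$, and $\mathbf{x}=(x_n)_{n\ge0}$ is a sequence converging to $\xi$, then $q_{\mathbf{x}}(g)=\limsup_{n\to\infty}\big(d(gx_0,x_n)-d(x_0,x_n)\big)$ is a quasimorphism whose homogenization does not depend on $\mathbf{x}$; this homogenization is the Busemann quasimorphism $\beta_\xi:K\to\mathbb{R}$.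 The action of $K$ is called regular if the Busemann quasimorphism (here $\beta_{\xi_+}$) is a homomorphism. Given a homomorphism $\varepsilon:G\to\{\pm1\}$, an $\varepsilon$-quasicocycle is a map $\varphi:G\to\mathbb{R}$ whose defect $D(\varphi)=\sup_{g,h\in G}|\varphi(gh)-\varphi(g)-\varepsilon(g)\varphi(h)|$ is finite; it is an $\varepsilon$-cocycle if $D(\varphi)=0$. *)

theory Defs
  imports "HOL-Analysis.Analysis" "HOL-Algebra.Group_Action" "HOL-Algebra.Sym_Groups"
begin

section \<open>Hyperbolic spaces and their Gromov boundary\<close>

definition geodesic_space :: "'x::metric_space itself \<Rightarrow> bool" where
  "geodesic_space _ \<longleftrightarrow> (\<forall>x y :: 'x. \<exists>\<gamma> :: real \<Rightarrow> 'x. \<gamma> 0 = x \<and> \<gamma> (dist x y) = y \<and>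
     (\<forall>s\<in>{0..dist x y}. \<forall>t\<in>{0..dist x y}. dist (\<gamma> s) (\<gamma> t) = \<bar>s - t\<bar>))"

definition gromov_product :: "'x::metric_space \<Rightarrow> 'x \<Rightarrow> 'x \<Rightarrow> real" where
  "gromov_product w x y = (dist w x + dist w y - dist x y) / 2"

definition gromov_hyperbolic :: "'x::metric_space itself \<Rightarrow> bool" where
  "gromov_hyperbolic _ \<longleftrightarrow> (\<exists>\<delta>\<ge>0. \<forall>w x y z :: 'x.
     gromov_product w x z \<ge> min (gromov_product w x y) (gromov_product w y z) - \<delta>)"

definition hyperbolic_space :: "'x::metric_space itself \<Rightarrow> bool" where
  "hyperbolic_space T \<longleftrightarrow> geodesic_space T \<and> gromov_hyperbolic T"

text \<open>The space need not be proper, so the boundary is the sequential one: equivalence classes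
  of sequences converging to infinity. The choice of the base point \<open>w\<close> is immaterial; quantifying
  over all base points avoids fixing one.\<close>

definition converges_to_infinity :: "(nat \<Rightarrow> 'x::metric_space) \<Rightarrow> bool" where
  "converges_to_infinity s \<longleftrightarrow>
     (\<forall>w. \<forall>C. \<exists>N. \<forall>m\<ge>N. \<forall>n\<ge>N. gromov_product w (s m) (s n) \<ge> C)"

definition boundary_rel :: "((nat \<Rightarrow> 'x::metric_space) \<times> (nat \<Rightarrow> 'x)) set" where
  "boundary_rel = {(s, t). converges_to_infinity s \<and> converges_to_infinity t \<and>
     (\<forall>w. filterlim (\<lambda>n. gromov_product w (s n) (t n)) at_top sequentially)}"

text \<open>A boundary point \<open>\<xi>\<close> is the set of all sequences of points of the space converging to it,
  so \<open>s \<in> \<xi>\<close> says that \<open>s\<close> converges to \<open>\<xi>\<close>.\<close>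

definition gromov_boundary :: "(nat \<Rightarrow> 'x::metric_space) set set" where
  "gromov_boundary = {s. converges_to_infinity s} // boundary_rel"


section \<open>Lineal actions\<close>

definition isometric_action :: "('g, 'm) monoid_scheme \<Rightarrow> ('g \<Rightarrow> 'x \<Rightarrow> 'x::metric_space) \<Rightarrow> bool" where
  "isometric_action G \<alpha> \<longleftrightarrow> group_action G UNIV \<alpha> \<and>
     (\<forall>g\<in>carrier G. \<forall>x y. dist (\<alpha> g x) (\<alpha> g y) = dist x y)"

definition boundary_action ::
  "('g \<Rightarrow> 'x \<Rightarrow> 'x) \<Rightarrow> 'g \<Rightarrow> (nat \<Rightarrow> 'x) set \<Rightarrow> (nat \<Rightarrow> 'x) set" where
  "boundary_action \<alpha> g \<xi> = (\<lambda>s. \<alpha> g \<circ> s) ` \<xi>"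

definition accumulation_points :: "'x::metric_space set \<Rightarrow> (nat \<Rightarrow> 'x) set set" where
  "accumulation_points S = {\<xi> \<in> gromov_boundary. \<exists>s\<in>\<xi>. range s \<subseteq> S}"

text \<open>For an isometric action all orbits have the same accumulation points, so the union below is
  the set of accumulation points of any single orbit.\<close>

definition limit_set ::
  "('g, 'm) monoid_scheme \<Rightarrow> ('g \<Rightarrow> 'x \<Rightarrow> 'x::metric_space) \<Rightarrow> (nat \<Rightarrow> 'x) set set" where
  "limit_set G \<alpha> = (\<Union>x. accumulation_points (orbit G \<alpha> x))"

definition lineal_action :: "('g, 'm) monoid_scheme \<Rightarrow> ('g \<Rightarrow> 'x \<Rightarrow> 'x::metric_space) \<Rightarrow> bool" where
  "lineal_action G \<alpha> \<longleftrightarrow> isometric_action G \<alpha> \<and> card (limit_set G \<alpha>) = 2"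

definition swaps ::
  "('g \<Rightarrow> 'x \<Rightarrow> 'x) \<Rightarrow> 'g \<Rightarrow> (nat \<Rightarrow> 'x) set \<Rightarrow> (nat \<Rightarrow> 'x) set \<Rightarrow> bool" where
  "swaps \<alpha> g \<xi> \<eta> \<longleftrightarrow> boundary_action \<alpha> g \<xi> = \<eta> \<and> boundary_action \<alpha> g \<eta> = \<xi>"

definition orientable_lineal_action ::
  "('g, 'm) monoid_scheme \<Rightarrow> ('g \<Rightarrow> 'x \<Rightarrow> 'x::metric_space) \<Rightarrow> bool" where
  "orientable_lineal_action G \<alpha> \<longleftrightarrow> lineal_action G \<alpha> \<and>
     \<not> (\<exists>g\<in>carrier G. \<exists>\<xi>\<in>limit_set G \<alpha>. \<exists>\<eta>\<in>limit_set G \<alpha>. \<xi> \<noteq> \<eta> \<and> swaps \<alpha> g \<xi> \<eta>)"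

definition nonorientable_lineal_action ::
  "('g, 'm) monoid_scheme \<Rightarrow> ('g \<Rightarrow> 'x \<Rightarrow> 'x::metric_space) \<Rightarrow> bool" where
  "nonorientable_lineal_action G \<alpha> \<longleftrightarrow> lineal_action G \<alpha> \<and> \<not> orientable_lineal_action G \<alpha>"


section \<open>Quasimorphisms and quasicocycles\<close>

text \<open>Defects are extended reals, so that an infinite supremum is a genuine value.\<close>

definition defect :: "('g, 'm) monoid_scheme \<Rightarrow> ('g \<Rightarrow> real) \<Rightarrow> ereal" where
  "defect K q = (SUP (g, h) \<in> carrier K \<times> carrier K. ereal \<bar>q (g \<otimes>\<^bsub>K\<^esub> h) - q g - q h\<bar>)"

definition homogenization :: "('g, 'm) monoid_scheme \<Rightarrow> ('g \<Rightarrow> real) \<Rightarrow> 'g \<Rightarrow> real" where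
  "homogenization K q g = lim (\<lambda>n::nat. q (g [^]\<^bsub>K\<^esub> n) / real n)"

text \<open>The group \<open>{\<plusminus>1}\<close> is the library's \<open>sign_img\<close>.\<close>

definition cocycle_defect ::
  "('g, 'm) monoid_scheme \<Rightarrow> ('g \<Rightarrow> int) \<Rightarrow> ('g \<Rightarrow> real) \<Rightarrow> ereal" where
  "cocycle_defect G \<epsilon> \<phi> = (SUP (g, h) \<in> carrier G \<times> carrier G.
     ereal \<bar>\<phi> (g \<otimes>\<^bsub>G\<^esub> h) - \<phi> g - of_int (\<epsilon> g) * \<phi> h\<bar>)"

definition quasicocycle ::
  "('g, 'm) monoid_scheme \<Rightarrow> ('g \<Rightarrow> int) \<Rightarrow> ('g \<Rightarrow> real) \<Rightarrow> bool" where
  "quasicocycle G \<epsilon> \<phi> \<longleftrightarrow> \<epsilon> \<in> hom G sign_img \<and> cocycle_defect G \<epsilon> \<phi> < \<infinity>"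

definition cocycle ::
  "('g, 'm) monoid_scheme \<Rightarrow> ('g \<Rightarrow> int) \<Rightarrow> ('g \<Rightarrow> real) \<Rightarrow> bool" where
  "cocycle G \<epsilon> \<phi> \<longleftrightarrow> quasicocycle G \<epsilon> \<phi> \<and> cocycle_defect G \<epsilon> \<phi> = 0"


section \<open>The Busemann quasimorphism\<close>

text \<open>The sequence under the \<open>limsup\<close> is bounded by \<open>dist (\<alpha> g (s 0)) (s 0)\<close>, so its upper limit
  is a real number.\<close>

definition busemann_seq :: "('g \<Rightarrow> 'x \<Rightarrow> 'x::metric_space) \<Rightarrow> (nat \<Rightarrow> 'x) \<Rightarrow> 'g \<Rightarrow> real" where
  "busemann_seq \<alpha> s g =
     real_of_ereal (limsup (\<lambda>n. ereal (dist (\<alpha> g (s 0)) (s n) - dist (s 0) (s n))))"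

text \<open>The common value of the homogenizations over all sequences converging to \<open>\<xi>\<close>; meaningful
  when \<open>K\<close> acts isometrically on a hyperbolic space and fixes the boundary point \<open>\<xi>\<close>.\<close>

definition busemann ::
  "('g, 'm) monoid_scheme \<Rightarrow> ('g \<Rightarrow> 'x \<Rightarrow> 'x::metric_space) \<Rightarrow> (nat \<Rightarrow> 'x) set \<Rightarrow> 'g \<Rightarrow> real" where
  "busemann K \<alpha> \<xi> g = (THE b. \<forall>s\<in>\<xi>. homogenization K (busemann_seq \<alpha> s) g = b)"

definition regular_action ::
  "('g, 'm) monoid_scheme \<Rightarrow> ('g \<Rightarrow> 'x \<Rightarrow> 'x::metric_space) \<Rightarrow> (nat \<Rightarrow> 'x) set \<Rightarrow> bool" where
  "regular_action K \<alpha> \<xi> \<longleftrightarrow> (\<forall>g\<in>carrier K. \<forall>h\<in>carrier K.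
     busemann K \<alpha> \<xi> (g \<otimes>\<^bsub>K\<^esub> h) = busemann K \<alpha> \<xi> g + busemann K \<alpha> \<xi> h)"

end

theory Submission
  imports Defs
begin

text \<open>Write \<open>\<beta>\<close> for the Busemann quasimorphism of \<open>K\<close> at \<open>\<xi>\<^sub>p\<close> and fix an element \<open>t\<close> that swaps the two
  limit points. The whole proof rests on one symmetry: \<open>\<beta> (t k t\<inverse>) = - \<beta> k\<close> for \<open>k\<close> in \<open>K\<close>.

  It holds for two reasons. Transporting everything by \<open>t\<close> turns the Busemann quasimorphism at
  \<open>\<xi>\<^sub>p\<close> of \<open>k\<close> into the one at \<open>\<xi>\<^sub>m\<close> of \<open>t k t\<inverse>\<close> (\<open>busemann_seq_conjugate\<close>). And moving towards one
  end of a line means moving away from the other: up to a bounded error, the Busemann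
  quasimorphisms at \<open>\<xi>\<^sub>p\<close> and \<open>\<xi>\<^sub>m\<close> are opposite on the elements fixing both points
  (\<open>busemann_seq_opposite_ends\<close>), because their sum at \<open>g\<close> is twice the difference of the Gromov
  products of the two ends based at \<open>g x\<close> and at \<open>x\<close>, and by hyperbolicity these products stay
  bounded. Homogenization kills the bounded error (\<open>busemann_conjugate_swap\<close>).

  The extension then sets \<open>\<phi> k = \<phi> (k t) = \<beta> k\<close> for \<open>k\<close> in \<open>K\<close>. Evaluating \<open>\<phi>\<close> on a product of two
  elements splits \<open>\<beta>\<close> along a product of two factors, or of three when both elements lie outside
  \<open>K\<close>, whence the factor 2 in the defect. The third factor is \<open>t\<^sup>2\<close>, which commutes with \<open>t\<close>, so
  the symmetry forces \<open>\<beta> (t\<^sup>2) = 0\<close> (\<open>anti_invariant_extension\<close>). The defect of \<open>\<phi>\<close> lies between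
  that of its restriction \<open>\<beta>\<close> and twice that, so it vanishes exactly when \<open>\<beta>\<close> is a homomorphism.

  Two further points need hyperbolicity: that \<open>\<beta>\<close> is defined at all, i.e. does not depend on the
  sequence, and that it has finite defect. Both come from the fact that differences of distances
  to points tending to the same boundary point agree in the limit up to a constant which depends
  on the space only (\<open>distance_differences_converge\<close>).\<close>

section \<open>Homogenization of quasimorphisms\<close>

text \<open>A bounded perturbation does not change the linear growth rate. This turns estimates up to a
  constant into exact identities between homogenizations.\<close>

lemma bounded_difference_same_rate:
  fixes a b :: "nat \<Rightarrow> real"
  assumes a: "(\<lambda>n. a n / real n) \<longlonglongrightarrow> L" and C: "\<And>n. \<bar>a n - b n\<bar> \<le> C"
  shows "(\<lambda>n. b n / real n) \<longlonglongrightarrow> L"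
proof -
  have bound: "norm (b n / real n - a n / real n) \<le> C * inverse (real n)" for n
    using C[of n] by (cases "n = 0") (auto simp: field_simps)
  have "(\<lambda>n. C * inverse (real n)) \<longlonglongrightarrow> C * 0"
    by (intro tendsto_mult_left lim_inverse_n)
  then have "(\<lambda>n. b n / real n - a n / real n) \<longlonglongrightarrow> 0"
    by (rule_tac Lim_null_comparison[OF eventuallyI]) (use bound in auto)
  from tendsto_add[OF a this] show ?thesis by simp
qed

lemma almost_additive_multiple:
  fixes c :: "nat \<Rightarrow> real"
  assumes D: "\<And>m n. \<bar>c (m + n) - c m - c n\<bar> \<le> D" and "m > 0"
  shows "\<bar>c (m * n) - m * c n\<bar> \<le> m * D"
  using \<open>m > 0\<close>
proof (induction m rule: nat_induct_non_zero)
  case 1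
  have "0 \<le> D" using D[of 0 0] by linarith
  then show ?case by simp
next
  case (Suc m)
  then show ?case using D[of n "m * n"] by (simp add: algebra_simps)
qed

text \<open>Computing \<open>c (m * n)\<close> as \<open>m\<close> blocks of length \<open>n\<close>, or as \<open>n\<close> blocks of length \<open>m\<close>, shows that
  \<open>c m / m\<close> and \<open>c n / n\<close> both lie close to \<open>c (m * n) / (m * n)\<close>, so the quotients form a Cauchy
  sequence.\<close>

lemma almost_additive_rate:
  fixes c :: "nat \<Rightarrow> real"
  assumes D: "\<And>m n. \<bar>c (m + n) - c m - c n\<bar> \<le> D"
  obtains L where "(\<lambda>n. c n / real n) \<longlonglongrightarrow> L" "\<bar>L - c 1\<bar> \<le> D"
proof -
  have D0: "0 \<le> D" using D[of 0 0] by linarith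
  have close: "\<bar>c (m * n) / (real m * real n) - c n / n\<bar> \<le> D / n" if "m > 0" "n > 0" for m n
  proof -
    have "\<bar>c (m * n) / (real m * real n) - c n / n\<bar> = \<bar>c (m * n) - m * c n\<bar> / (real m * real n)"
      using that by (simp add: field_simps flip: abs_mult_pos')
    also have "\<dots> \<le> m * D / (real m * real n)"
      using almost_additive_multiple[of c D, OF D \<open>m > 0\<close>] by (intro divide_right_mono) auto
    finally show ?thesis using that by simp
  qed
  have rate: "\<bar>c m / m - c n / n\<bar> \<le> D / m + D / n" if "m > 0" "n > 0" for m n
    using close[OF that] close[OF that(2,1)] by (simp add: mult.commute)
  have "Cauchy (\<lambda>n. c n / real n)"
  proof (rule metric_CauchyI)
    fix e :: real assume "e > 0"
    obtain M where M: "real M > 2 * D / e" using reals_Archimedean2 by blast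
    have small: "D / n < e / 2" if "n \<ge> Suc M" for n
    proof -
      have "2 * D < real M * e" using M \<open>e > 0\<close> by (simp add: field_simps)
      also have "\<dots> \<le> real n * e" using that \<open>e > 0\<close> by simp
      finally show ?thesis using that by (simp add: field_simps)
    qed
    show "\<exists>M. \<forall>m\<ge>M. \<forall>n\<ge>M. dist (c m / real m) (c n / real n) < e"
    proof (intro exI[of _ "Suc M"] allI impI)
      fix m n assume "m \<ge> Suc M" "n \<ge> Suc M"
      then show "dist (c m / real m) (c n / real n) < e"
        using small[of m] small[of n] rate[of m n] unfolding dist_real_def by linarith
    qed
  qed
  then obtain L where L: "(\<lambda>n. c n / real n) \<longlonglongrightarrow> L"
    using real_Cauchy_convergent convergent_def by blast
  have "\<bar>c n / real n - c 1\<bar> \<le> D" if "n \<ge> 1" for n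
    using close[of n 1] that by simp
  then have "\<bar>L - c 1\<bar> \<le> D"
    by (intro tendsto_upperbound[OF tendsto_rabs[OF tendsto_diff[OF L tendsto_const]]])
       (auto simp: eventually_sequentially)
  with L that show ?thesis by blast
qed

text \<open>The second claim makes the defect of the homogenization finite: it is a quasimorphism because
  it stays within bounded distance of one.\<close>

lemma homogenization_tendsto:
  fixes q :: "'g \<Rightarrow> real"
  assumes "group K" "g \<in> carrier K"
    and D: "\<And>g h. g \<in> carrier K \<Longrightarrow> h \<in> carrier K \<Longrightarrow> \<bar>q (g \<otimes>\<^bsub>K\<^esub> h) - q g - q h\<bar> \<le> D"
  shows "(\<lambda>n::nat. q (g [^]\<^bsub>K\<^esub> n) / real n) \<longlonglongrightarrow> homogenization K q g"
    and "\<bar>homogenization K q g - q g\<bar> \<le> D"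
proof -
  interpret group K by fact
  have "\<bar>q (g [^]\<^bsub>K\<^esub> (m + n)) - q (g [^]\<^bsub>K\<^esub> m) - q (g [^]\<^bsub>K\<^esub> n)\<bar> \<le> D" for m n :: nat
    using D[of "g [^]\<^bsub>K\<^esub> m" "g [^]\<^bsub>K\<^esub> n"] assms(2) by (simp add: nat_pow_mult)
  then obtain L where L: "(\<lambda>n::nat. q (g [^]\<^bsub>K\<^esub> n) / real n) \<longlonglongrightarrow> L"
      and near: "\<bar>L - q (g [^]\<^bsub>K\<^esub> (1::nat))\<bar> \<le> D"
    using almost_additive_rate[of "\<lambda>n. q (g [^]\<^bsub>K\<^esub> n)" D] by metis
  have "homogenization K q g = L"
    unfolding homogenization_def by (rule limI) (rule L)
  with L near assms(2) show "(\<lambda>n::nat. q (g [^]\<^bsub>K\<^esub> n) / real n) \<longlonglongrightarrow> homogenization K q g"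
    and "\<bar>homogenization K q g - q g\<bar> \<le> D"
    by simp_all
qed

section \<open>Powers of conjugates\<close>

lemma (in group) inv_mult_cancel: "t \<in> carrier G \<Longrightarrow> x \<in> carrier G \<Longrightarrow> inv t \<otimes> (t \<otimes> x) = x"
  by (metis inv_closed l_inv l_one m_assoc)

lemma (in group) conj_pow:
  assumes "t \<in> carrier G" "k \<in> carrier G"
  shows "(t \<otimes> k \<otimes> inv t) [^] (n::nat) = t \<otimes> k [^] n \<otimes> inv t"
proof (induction n)
  case (Suc n)
  have "(t \<otimes> k \<otimes> inv t) [^] Suc n = (t \<otimes> k [^] n \<otimes> inv t) \<otimes> (t \<otimes> k \<otimes> inv t)"
    using Suc by (simp only: nat_pow_Suc)
  also have "\<dots> = t \<otimes> k [^] Suc n \<otimes> inv t"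
    using assms by (simp add: m_assoc inv_mult_cancel)
  finally show ?case .
qed (use assms in simp)

section \<open>Boundary points of hyperbolic spaces\<close>

lemma gromov_product_commute: "gromov_product w x y = gromov_product w y x"
  by (simp add: gromov_product_def dist_commute)

lemma gromov_hyperbolicE:
  assumes "gromov_hyperbolic TYPE('x::metric_space)"
  obtains \<delta> where "\<delta> \<ge> 0" and "\<And>w x y z :: 'x.
    min (gromov_product w x y) (gromov_product w y z) - \<delta> \<le> gromov_product w x z"
  using assms unfolding gromov_hyperbolic_def by blast

lemma boundary_rel_refl:
  assumes "converges_to_infinity s"
  shows "(s, s) \<in> boundary_rel"
proof -
  have "\<forall>\<^sub>F n in sequentially. C \<le> gromov_product w (s n) (s n)" for w C
    using assms unfolding converges_to_infinity_def eventually_sequentially by blast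
  then show ?thesis
    using assms unfolding boundary_rel_def filterlim_at_top by simp
qed

lemma boundary_rel_sym: "(s, t) \<in> boundary_rel \<Longrightarrow> (t, s) \<in> boundary_rel"
  unfolding boundary_rel_def by (simp add: gromov_product_commute)

lemma boundary_rel_eventually:
  assumes "(s, t) \<in> boundary_rel"
  shows "\<forall>\<^sub>F n in sequentially. gromov_product w (s n) (t n) \<ge> C"
  using assms unfolding boundary_rel_def filterlim_at_top by blast

lemma boundary_rel_trans:
  fixes s t u :: "nat \<Rightarrow> 'x::metric_space"
  assumes hyp: "gromov_hyperbolic TYPE('x)"
    and st: "(s, t) \<in> boundary_rel" and tu: "(t, u) \<in> boundary_rel"
  shows "(s, u) \<in> boundary_rel"
proof -
  obtain \<delta> where \<delta>: "\<And>w x y z :: 'x.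
      min (gromov_product w x y) (gromov_product w y z) - \<delta> \<le> gromov_product w x z"
    using gromov_hyperbolicE[OF hyp] by metis
  have "\<forall>\<^sub>F n in sequentially. C \<le> gromov_product w (s n) (u n)" for w C
    using boundary_rel_eventually[OF st, where w = w and C = "C + \<delta>"]
      boundary_rel_eventually[OF tu, where w = w and C = "C + \<delta>"]
  proof eventually_elim
    case (elim n)
    then show ?case using \<delta>[of w "s n" "t n" "u n"] by linarith
  qed
  then show ?thesis
    using st tu unfolding boundary_rel_def filterlim_at_top by simp
qed

lemma equiv_boundary_rel:
  assumes "gromov_hyperbolic TYPE('x::metric_space)"
  shows "equiv {s. converges_to_infinity s} (boundary_rel :: ((nat \<Rightarrow> 'x) \<times> (nat \<Rightarrow> 'x)) set)"
proof (rule equivI)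
  show "boundary_rel \<subseteq> {s. converges_to_infinity s} \<times> {s::nat \<Rightarrow> 'x. converges_to_infinity s}"
    by (auto simp: boundary_rel_def)
  show "refl_on {s::nat \<Rightarrow> 'x. converges_to_infinity s} boundary_rel"
    by (simp add: refl_on_def boundary_rel_refl)
  show "sym (boundary_rel :: ((nat \<Rightarrow> 'x) \<times> (nat \<Rightarrow> 'x)) set)"
    using boundary_rel_sym by (rule symI)
  show "trans (boundary_rel :: ((nat \<Rightarrow> 'x) \<times> (nat \<Rightarrow> 'x)) set)"
    using boundary_rel_trans[OF assms] by (rule transI)
qed

text \<open>The relation compares the two sequences at equal indices; since each of them converges to
  infinity, the indices may also go to infinity independently.\<close>

lemma boundary_rel_independent_indices:
  fixes s t :: "nat \<Rightarrow> 'x::metric_space"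
  assumes hyp: "gromov_hyperbolic TYPE('x)" and st: "(s, t) \<in> boundary_rel"
  obtains N where "\<And>m n. m \<ge> N \<Longrightarrow> n \<ge> N \<Longrightarrow> gromov_product w (s m) (t n) \<ge> C"
proof -
  obtain \<delta> where \<delta>: "\<And>w x y z :: 'x.
      min (gromov_product w x y) (gromov_product w y z) - \<delta> \<le> gromov_product w x z"
    using gromov_hyperbolicE[OF hyp] by metis
  obtain N1 where N1: "\<And>n. n \<ge> N1 \<Longrightarrow> gromov_product w (s n) (t n) \<ge> C + \<delta>"
    using boundary_rel_eventually[OF st] unfolding eventually_sequentially by meson
  obtain N2 where N2: "\<And>m n. m \<ge> N2 \<Longrightarrow> n \<ge> N2 \<Longrightarrow> gromov_product w (t m) (t n) \<ge> C + \<delta>"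
    using st unfolding boundary_rel_def converges_to_infinity_def by blast
  show ?thesis
  proof (rule that[of "max N1 N2"])
    fix m n assume "m \<ge> max N1 N2" "n \<ge> max N1 N2"
    then show "gromov_product w (s m) (t n) \<ge> C"
      using N1[of m] N2[of m n] \<delta>[of w "s m" "t m" "t n"] by simp
  qed
qed

text \<open>The basic rigidity of horofunctions: the constant depends neither on the points nor on the
  sequences. Because it is uniform, \<open>busemann_seq\<close> is a quasimorphism and not merely a function.\<close>

lemma distance_differences_converge:
  assumes hyp: "gromov_hyperbolic TYPE('x::metric_space)"
  obtains c where "\<And>(s::nat \<Rightarrow> 'x) t x y. (s, t) \<in> boundary_rel \<Longrightarrow>
    \<exists>N. \<forall>m\<ge>N. \<forall>n\<ge>N. \<bar>(dist x (s m) - dist y (s m)) - (dist x (t n) - dist y (t n))\<bar> \<le> c"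
proof -
  obtain \<delta> where \<delta>0: "\<delta> \<ge> 0" and \<delta>: "\<And>w x y z :: 'x.
      min (gromov_product w x y) (gromov_product w y z) - \<delta> \<le> gromov_product w x z"
    using gromov_hyperbolicE[OF hyp] by metis
  (* If a and b are far out in the same direction as seen from p, the second term of the minimum
     in the inequality based at p is huge, so the first one is the minimum. *)
  have one_sided: "(dist p a - dist q a) - (dist p b - dist q b) \<le> 2 * \<delta>"
    if "gromov_product p a b \<ge> dist p q + \<delta> + 1" for p q a b :: 'x
  proof -
    have "gromov_product p b q \<le> dist p q"
      using dist_triangle[of p b q] by (simp add: gromov_product_def dist_commute)
    then have "gromov_product p q a - \<delta> \<le> gromov_product p q b"
      using \<delta>[of p q a b] that \<delta>0 gromov_product_commute[of p q b] by linarith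
    then show ?thesis by (simp add: gromov_product_def field_simps)
  qed
  show ?thesis
  proof (rule that[of "2 * \<delta>"])
    fix s t :: "nat \<Rightarrow> 'x" and x y
    assume st: "(s, t) \<in> boundary_rel"
    obtain N where N: "\<And>m n. m \<ge> N \<Longrightarrow> n \<ge> N \<Longrightarrow> gromov_product x (s m) (t n) \<ge> dist x y + \<delta> + 1"
      using boundary_rel_independent_indices[OF hyp st] by metis
    have "\<bar>(dist x (s m) - dist y (s m)) - (dist x (t n) - dist y (t n))\<bar> \<le> 2 * \<delta>"
      if "m \<ge> N" "n \<ge> N" for m n
      using one_sided[OF N[OF that]] one_sided[of x y "t n" "s m"] N[OF that]
      by (simp add: gromov_product_commute)
    then show "\<exists>N. \<forall>m\<ge>N. \<forall>n\<ge>N.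
        \<bar>(dist x (s m) - dist y (s m)) - (dist x (t n) - dist y (t n))\<bar> \<le> 2 * \<delta>"
      by blast
  qed
qed

text \<open>For two fixed sequences with distinct limits the Gromov products are small infinitely often, by
  definition. If they were large for some other pair of sequences with these limits, passing from
  \<open>s\<close> through \<open>s'\<close> and \<open>u'\<close> to \<open>u\<close> would make them large for \<open>s\<close> and \<open>u\<close> as well. The bound is the same
  for all pairs, so it can be applied to all translates by a group fixing both limits.\<close>

lemma distinct_boundary_points_product_bounded:
  fixes s u :: "nat \<Rightarrow> 'x::metric_space"
  assumes hyp: "gromov_hyperbolic TYPE('x)"
    and conv: "converges_to_infinity s" "converges_to_infinity u"
    and su: "(s, u) \<notin> boundary_rel"
  obtains C where "\<And>s' u'. (s', s) \<in> boundary_rel \<Longrightarrow> (u, u') \<in> boundary_rel \<Longrightarrow>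
    \<forall>\<^sub>F n in sequentially. gromov_product x (s' n) (u' n) \<le> C"
proof -
  obtain \<delta> where \<delta>0: "\<delta> \<ge> 0" and \<delta>: "\<And>w x y z :: 'x.
      min (gromov_product w x y) (gromov_product w y z) - \<delta> \<le> gromov_product w x z"
    using gromov_hyperbolicE[OF hyp] by metis
  obtain w A where A: "\<exists>\<^sub>F n in sequentially. gromov_product w (s n) (u n) < A"
    using su conv unfolding boundary_rel_def filterlim_at_top
    by (auto simp: not_eventually not_le)
  have change_base: "gromov_product x a b \<le> gromov_product w a b + dist x w" for a b
    using dist_triangle[of x a w] dist_triangle[of x b w]
    by (simp add: gromov_product_def field_simps)
  show ?thesis
  proof (rule that[of "A + 2 * \<delta> + dist x w"])
    fix s' u' :: "nat \<Rightarrow> 'x"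
    assume s': "(s', s) \<in> boundary_rel" and u': "(u, u') \<in> boundary_rel"
    obtain N1 where N1: "\<And>m n. m \<ge> N1 \<Longrightarrow> n \<ge> N1 \<Longrightarrow> gromov_product w (s' m) (s n) \<ge> A + 2 * \<delta>"
      using boundary_rel_independent_indices[OF hyp s'] by metis
    obtain N2 where N2: "\<And>m n. m \<ge> N2 \<Longrightarrow> n \<ge> N2 \<Longrightarrow> gromov_product w (u m) (u' n) \<ge> A + 2 * \<delta>"
      using boundary_rel_independent_indices[OF hyp u'] by metis
    (* An index at which the product of s and u is small, yet past which all comparisons with
       s' and u' are available. *)
    obtain k where k: "k \<ge> max N1 N2" "gromov_product w (s k) (u k) < A"
      using A unfolding frequently_sequentially by blast
    have "gromov_product x (s' n) (u' n) \<le> A + 2 * \<delta> + dist x w" if "n \<ge> max N1 N2" for n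
    proof (rule ccontr)
      assume "\<not> ?thesis"
      then have "gromov_product w (s' n) (u' n) > A + 2 * \<delta>"
        using change_base[of "s' n" "u' n"] by linarith
      moreover have "gromov_product w (s k) (s' n) \<ge> A + 2 * \<delta>"
        using N1[of n k] k that by (simp add: gromov_product_commute)
      ultimately have "gromov_product w (s k) (u' n) \<ge> A + \<delta>"
        using \<delta>[of w "s k" "s' n" "u' n"] by linarith
      moreover have "gromov_product w (u' n) (u k) \<ge> A + 2 * \<delta>"
        using N2[of k n] k that by (simp add: gromov_product_commute)
      ultimately show False
        using \<delta>[of w "s k" "u' n" "u k"] k(2) \<delta>0 by linarith
    qed
    then show "\<forall>\<^sub>F n in sequentially. gromov_product x (s' n) (u' n) \<le> A + 2 * \<delta> + dist x w"
      unfolding eventually_sequentially by blast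
  qed
qed

text \<open>The hypothesis keeps the upper limit finite, so that \<open>real_of_ereal\<close> does not return its
  default value.\<close>

lemma limsup_near_real:
  fixes f :: "nat \<Rightarrow> real"
  assumes ev: "\<forall>\<^sub>F n in sequentially. \<bar>f n - r\<bar> \<le> c"
  shows "\<bar>real_of_ereal (limsup (\<lambda>n. ereal (f n))) - r\<bar> \<le> c"
proof -
  have "limsup (\<lambda>n. ereal (f n)) \<le> ereal (r + c)"
    by (rule Limsup_bounded, rule eventually_mono[OF ev]) auto
  moreover have "ereal (r - c) \<le> limsup (\<lambda>n. ereal (f n))"
    by (rule le_Limsup, simp, rule eventually_mono[OF ev]) auto
  ultimately show ?thesis
    by (cases "limsup (\<lambda>n. ereal (f n))") auto
qed

section \<open>Isometric actions and the boundary\<close>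

locale isometric_group_action =
  fixes G :: "('g, 'm) monoid_scheme" (structure)
    and \<alpha> :: "'g \<Rightarrow> 'x \<Rightarrow> 'x::metric_space"
  assumes action: "isometric_action G \<alpha>"
    and hyp: "gromov_hyperbolic TYPE('x)"
begin

sublocale group_action G UNIV \<alpha>
  using action by (simp add: isometric_action_def)

sublocale group G
  using group_hom group_hom.axioms(1) by blast

lemma act_mult: "g \<in> carrier G \<Longrightarrow> h \<in> carrier G \<Longrightarrow> \<alpha> (g \<otimes> h) x = \<alpha> g (\<alpha> h x)"
  by (rule composition_rule) simp_all

lemma act_one [simp]: "\<alpha> \<one> x = x"
  by (metis id_eq_one restrict_UNIV)

lemma act_inv [simp]:
  assumes "g \<in> carrier G"
  shows "\<alpha> g (\<alpha> (inv g) x) = x" "\<alpha> (inv g) (\<alpha> g x) = x"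
  using assms act_mult[of g "inv g" x] act_mult[of "inv g" g x] by simp_all

lemma act_dist [simp]: "g \<in> carrier G \<Longrightarrow> dist (\<alpha> g x) (\<alpha> g y) = dist x y"
  using action by (simp add: isometric_action_def)

lemma act_dist_inv: "g \<in> carrier G \<Longrightarrow> dist (\<alpha> g x) y = dist x (\<alpha> (inv g) y)"
  by (metis act_inv(1) act_dist)

lemma gromov_product_act:
  assumes g: "g \<in> carrier G"
  shows "gromov_product w (\<alpha> g x) (\<alpha> g y) = gromov_product (\<alpha> (inv g) w) x y"
proof -
  have "dist w (\<alpha> g z) = dist (\<alpha> (inv g) w) z" for z
    using act_dist_inv[OF g, of z w] by (simp add: dist_commute)
  then show ?thesis using g by (simp add: gromov_product_def)
qed

lemma act_boundary_rel:
  assumes "g \<in> carrier G" "(s, t) \<in> boundary_rel"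
  shows "(\<alpha> g \<circ> s, \<alpha> g \<circ> t) \<in> boundary_rel"
  using assms unfolding boundary_rel_def converges_to_infinity_def
  by (simp add: gromov_product_act)

lemma comp_act_mult:
  "g \<in> carrier G \<Longrightarrow> h \<in> carrier G \<Longrightarrow> \<alpha> (g \<otimes> h) \<circ> s = \<alpha> g \<circ> (\<alpha> h \<circ> s)"
  by (simp add: fun_eq_iff act_mult)

lemma boundary_action_mult:
  "g \<in> carrier G \<Longrightarrow> h \<in> carrier G \<Longrightarrow>
    boundary_action \<alpha> (g \<otimes> h) \<xi> = boundary_action \<alpha> g (boundary_action \<alpha> h \<xi>)"
  by (simp add: boundary_action_def image_image comp_act_mult)

lemma boundary_action_one: "boundary_action \<alpha> \<one> \<xi> = \<xi>"
  by (simp add: boundary_action_def comp_def)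

lemma boundary_action_inv:
  "g \<in> carrier G \<Longrightarrow> boundary_action \<alpha> (inv g) (boundary_action \<alpha> g \<xi>) = \<xi>"
  using boundary_action_mult[of "inv g" g \<xi>] by (simp add: boundary_action_one)

lemma boundary_action_class:
  assumes g: "g \<in> carrier G"
  shows "boundary_action \<alpha> g (boundary_rel `` {s}) = boundary_rel `` {\<alpha> g \<circ> s}"
proof
  show "boundary_action \<alpha> g (boundary_rel `` {s}) \<subseteq> boundary_rel `` {\<alpha> g \<circ> s}"
    using act_boundary_rel[OF g] by (auto simp: boundary_action_def)
  show "boundary_rel `` {\<alpha> g \<circ> s} \<subseteq> boundary_action \<alpha> g (boundary_rel `` {s})"
  proof
    fix t assume "t \<in> boundary_rel `` {\<alpha> g \<circ> s}"
    then have "(\<alpha> (inv g) \<circ> (\<alpha> g \<circ> s), \<alpha> (inv g) \<circ> t) \<in> boundary_rel"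
      using act_boundary_rel[of "inv g" "\<alpha> g \<circ> s" t] g by simp
    moreover have "\<alpha> (inv g) \<circ> (\<alpha> g \<circ> s) = s" "t = \<alpha> g \<circ> (\<alpha> (inv g) \<circ> t)"
      using g by (simp_all add: fun_eq_iff)
    ultimately show "t \<in> boundary_action \<alpha> g (boundary_rel `` {s})"
      unfolding boundary_action_def by (metis ImageI imageI singletonI)
  qed
qed

lemma boundary_action_limit_set:
  assumes g: "g \<in> carrier G" and \<xi>: "\<xi> \<in> limit_set G \<alpha>"
  shows "boundary_action \<alpha> g \<xi> \<in> limit_set G \<alpha>"
proof -
  obtain x s where x: "\<xi> \<in> gromov_boundary" "s \<in> \<xi>" "range s \<subseteq> orbit G \<alpha> x"
    using \<xi> by (auto simp: limit_set_def accumulation_points_def)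
  obtain u where u: "converges_to_infinity u" "\<xi> = boundary_rel `` {u}"
    using x(1) by (auto simp: gromov_boundary_def elim: quotientE)
  have "boundary_action \<alpha> g \<xi> = boundary_rel `` {\<alpha> g \<circ> u}"
    using boundary_action_class[OF g] u by simp
  moreover have "converges_to_infinity (\<alpha> g \<circ> u)"
    using act_boundary_rel[OF g boundary_rel_refl[OF u(1)]] by (simp add: boundary_rel_def)
  ultimately have "boundary_action \<alpha> g \<xi> \<in> gromov_boundary"
    by (simp add: gromov_boundary_def quotientI)
  moreover have "\<alpha> g \<circ> s \<in> boundary_action \<alpha> g \<xi>"
    using x(2) by (simp add: boundary_action_def)
  moreover have "range (\<alpha> g \<circ> s) \<subseteq> orbit G \<alpha> x"
  proof
    fix y assume "y \<in> range (\<alpha> g \<circ> s)"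
    then obtain n where y: "y = \<alpha> g (s n)" by auto
    obtain h where "h \<in> carrier G" "s n = \<alpha> h x" using x(3) by (auto simp: orbit_def)
    then show "y \<in> orbit G \<alpha> x"
      using g y by (auto simp: orbit_def act_mult[symmetric] intro!: exI[of _ "g \<otimes> h"])
  qed
  ultimately show ?thesis
    unfolding limit_set_def accumulation_points_def by blast
qed

section \<open>The Busemann quasimorphism\<close>

text \<open>Up to a constant independent of the group element, \<open>busemann_seq\<close> may be computed with any base
  point, any equivalent sequence and any single late index in place of the upper limit. All further estimates are
  additions of such expressions at a common index.\<close>

lemma busemann_seq_near:
  obtains c where "\<And>s t g x. (s, t) \<in> boundary_rel \<Longrightarrow> g \<in> carrier G \<Longrightarrow>
    \<forall>\<^sub>F n in sequentially.
      \<bar>busemann_seq \<alpha> s g - (dist (\<alpha> g x) (t n) - dist x (t n))\<bar> \<le> c + 2 * dist x (s 0)"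
proof -
  obtain c where c: "\<And>(s::nat \<Rightarrow> 'x) t x y. (s, t) \<in> boundary_rel \<Longrightarrow>
      \<exists>N. \<forall>m\<ge>N. \<forall>n\<ge>N. \<bar>(dist x (s m) - dist y (s m)) - (dist x (t n) - dist y (t n))\<bar> \<le> c"
    using distance_differences_converge[OF hyp] by blast
  show ?thesis
  proof (rule that[of c])
    fix s t :: "nat \<Rightarrow> 'x" and g x
    assume st: "(s, t) \<in> boundary_rel" and g: "g \<in> carrier G"
    let ?y = "s 0"
    obtain N where N: "\<And>m n. m \<ge> N \<Longrightarrow> n \<ge> N \<Longrightarrow>
        \<bar>(dist (\<alpha> g ?y) (s m) - dist ?y (s m)) - (dist (\<alpha> g ?y) (t n) - dist ?y (t n))\<bar> \<le> c"
      using c[OF st, of "\<alpha> g ?y" ?y] by blast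
    have "\<bar>busemann_seq \<alpha> s g - (dist (\<alpha> g x) (t n) - dist x (t n))\<bar> \<le> c + 2 * dist x ?y"
      if "n \<ge> N" for n
    proof -
      have "\<bar>busemann_seq \<alpha> s g - (dist (\<alpha> g ?y) (t n) - dist ?y (t n))\<bar> \<le> c"
        unfolding busemann_seq_def
        by (rule limsup_near_real) (use N that in \<open>auto simp: eventually_sequentially\<close>)
      moreover have "\<bar>dist (\<alpha> g x) (t n) - dist (\<alpha> g ?y) (t n)\<bar> \<le> dist x ?y"
        using dist_triangle[of "\<alpha> g x" "t n" "\<alpha> g ?y"] dist_triangle[of "\<alpha> g ?y" "t n" "\<alpha> g x"] g
        by (simp add: dist_commute abs_le_iff)
      moreover have "\<bar>dist x (t n) - dist ?y (t n)\<bar> \<le> dist x ?y"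
        using dist_triangle[of x "t n" ?y] dist_triangle[of ?y "t n" x]
        by (simp add: dist_commute abs_le_iff)
      ultimately show ?thesis by linarith
    qed
    then show "\<forall>\<^sub>F n in sequentially.
        \<bar>busemann_seq \<alpha> s g - (dist (\<alpha> g x) (t n) - dist x (t n))\<bar> \<le> c + 2 * dist x (s 0)"
      unfolding eventually_sequentially by blast
  qed
qed

text \<open>At a single index the displacement of \<open>g \<otimes> h\<close> is the exact sum of that of \<open>g\<close> and of that of \<open>h\<close>
  measured along the sequence translated by \<open>inv g\<close>. The latter converges to the same boundary
  point when \<open>g\<close> fixes that point.\<close>

lemma busemann_seq_quasimorphism:
  obtains D where "\<And>s g h. (s, \<alpha> (inv g) \<circ> s) \<in> boundary_rel \<Longrightarrow>
    g \<in> carrier G \<Longrightarrow> h \<in> carrier G \<Longrightarrow>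
    \<bar>busemann_seq \<alpha> s (g \<otimes> h) - busemann_seq \<alpha> s g - busemann_seq \<alpha> s h\<bar> \<le> D"
proof -
  obtain c where c: "\<And>s t g x. (s, t) \<in> boundary_rel \<Longrightarrow> g \<in> carrier G \<Longrightarrow>
    \<forall>\<^sub>F n in sequentially.
      \<bar>busemann_seq \<alpha> s g - (dist (\<alpha> g x) (t n) - dist x (t n))\<bar> \<le> c + 2 * dist x (s 0)"
    by (rule busemann_seq_near[OF that])
  show ?thesis
  proof (rule that[of "3 * c"])
    fix s g h
    assume sg: "(s, \<alpha> (inv g) \<circ> s) \<in> boundary_rel" and g: "g \<in> carrier G" and h: "h \<in> carrier G"
    let ?x = "s 0"
    have ss: "(s, s) \<in> boundary_rel"
      using sg by (intro boundary_rel_refl) (simp add: boundary_rel_def)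
    have "\<forall>\<^sub>F n in sequentially.
        \<bar>busemann_seq \<alpha> s (g \<otimes> h) - busemann_seq \<alpha> s g - busemann_seq \<alpha> s h\<bar> \<le> 3 * c"
      using c[OF ss m_closed[OF g h], of ?x] c[OF ss g, of ?x] c[OF sg h, of ?x]
    proof eventually_elim
      case (elim n)
      have "dist (\<alpha> h ?x) (\<alpha> (inv g) (s n)) = dist (\<alpha> (g \<otimes> h) ?x) (s n)"
        "dist ?x (\<alpha> (inv g) (s n)) = dist (\<alpha> g ?x) (s n)"
        using g h by (simp_all add: act_dist_inv act_mult)
      then show ?case using elim by simp
    qed
    then show "\<bar>busemann_seq \<alpha> s (g \<otimes> h) - busemann_seq \<alpha> s g - busemann_seq \<alpha> s h\<bar> \<le> 3 * c"
      by simp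
  qed
qed

lemma busemann_seq_change_sequence:
  assumes "(s, t) \<in> boundary_rel"
  obtains C where "\<And>g. g \<in> carrier G \<Longrightarrow> \<bar>busemann_seq \<alpha> s g - busemann_seq \<alpha> t g\<bar> \<le> C"
proof -
  obtain c where c: "\<And>s t g x. (s, t) \<in> boundary_rel \<Longrightarrow> g \<in> carrier G \<Longrightarrow>
    \<forall>\<^sub>F n in sequentially.
      \<bar>busemann_seq \<alpha> s g - (dist (\<alpha> g x) (t n) - dist x (t n))\<bar> \<le> c + 2 * dist x (s 0)"
    by (rule busemann_seq_near[OF that])
  have tt: "(t, t) \<in> boundary_rel"
    using assms by (intro boundary_rel_refl) (simp add: boundary_rel_def)
  show ?thesis
  proof (rule that[of "2 * c + 2 * dist (t 0) (s 0)"])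
    fix g assume g: "g \<in> carrier G"
    have "\<forall>\<^sub>F n in sequentially.
        \<bar>busemann_seq \<alpha> s g - busemann_seq \<alpha> t g\<bar> \<le> 2 * c + 2 * dist (t 0) (s 0)"
      using c[OF assms g, of "t 0"] c[OF tt g, of "t 0"]
      by eventually_elim auto
    then show "\<bar>busemann_seq \<alpha> s g - busemann_seq \<alpha> t g\<bar> \<le> 2 * c + 2 * dist (t 0) (s 0)"
      by simp
  qed
qed

text \<open>Going towards one end means going away from the other. At a single index the sum of the two
  displacements equals twice the difference of two Gromov products; one is that of \<open>s\<close> and \<open>u\<close>, the
  other that of their translates by \<open>inv g\<close>. When \<open>g\<close> fixes both ends, the two pairs have
  the same distinct limits, so both products lie between 0 and a constant that does not depend
  on \<open>g\<close>.\<close>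

lemma busemann_seq_opposite_ends:
  assumes conv: "converges_to_infinity s" "converges_to_infinity u"
    and su: "(s, u) \<notin> boundary_rel"
  obtains C where "\<And>g. g \<in> carrier G \<Longrightarrow>
    (\<alpha> (inv g) \<circ> s, s) \<in> boundary_rel \<Longrightarrow> (u, \<alpha> (inv g) \<circ> u) \<in> boundary_rel \<Longrightarrow>
    \<bar>busemann_seq \<alpha> s g + busemann_seq \<alpha> u g\<bar> \<le> C"
proof -
  obtain c where c: "\<And>s t g x. (s, t) \<in> boundary_rel \<Longrightarrow> g \<in> carrier G \<Longrightarrow>
    \<forall>\<^sub>F n in sequentially.
      \<bar>busemann_seq \<alpha> s g - (dist (\<alpha> g x) (t n) - dist x (t n))\<bar> \<le> c + 2 * dist x (s 0)"
    by (rule busemann_seq_near[OF that])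
  let ?x = "s 0"
  obtain A where A: "\<And>s' u'. (s', s) \<in> boundary_rel \<Longrightarrow> (u, u') \<in> boundary_rel \<Longrightarrow>
      \<forall>\<^sub>F n in sequentially. gromov_product ?x (s' n) (u' n) \<le> A"
    using distinct_boundary_points_product_bounded[OF hyp conv su] by blast
  have pos: "gromov_product ?x a b \<ge> 0" for a b
    using dist_triangle[of a b ?x] by (simp add: gromov_product_def dist_commute)
  note ss = boundary_rel_refl[OF conv(1)] and uu = boundary_rel_refl[OF conv(2)]
  show ?thesis
  proof (rule that[of "2 * c + 2 * dist ?x (u 0) + 2 * A"])
    fix g assume g: "g \<in> carrier G"
      and gs: "(\<alpha> (inv g) \<circ> s, s) \<in> boundary_rel" and gu: "(u, \<alpha> (inv g) \<circ> u) \<in> boundary_rel"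
    have "\<forall>\<^sub>F n in sequentially.
        \<bar>busemann_seq \<alpha> s g + busemann_seq \<alpha> u g\<bar> \<le> 2 * c + 2 * dist ?x (u 0) + 2 * A"
      using c[OF ss g, of ?x] c[OF uu g, of ?x] A[OF ss uu] A[OF gs gu]
    proof eventually_elim
      case (elim n)
      have "(dist (\<alpha> g ?x) (s n) - dist ?x (s n)) + (dist (\<alpha> g ?x) (u n) - dist ?x (u n))
          = 2 * gromov_product ?x (\<alpha> (inv g) (s n)) (\<alpha> (inv g) (u n))
            - 2 * gromov_product ?x (s n) (u n)"
        using g by (simp add: gromov_product_def act_dist_inv field_simps)
      then show ?case
        using elim pos[of "s n" "u n"] pos[of "\<alpha> (inv g) (s n)" "\<alpha> (inv g) (u n)"] by simp
    qed
    then show "\<bar>busemann_seq \<alpha> s g + busemann_seq \<alpha> u g\<bar> \<le> 2 * c + 2 * dist ?x (u 0) + 2 * A"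
      by simp
  qed
qed

lemma busemann_seq_conjugate:
  assumes "t \<in> carrier G" "k \<in> carrier G"
  shows "busemann_seq \<alpha> (\<alpha> t \<circ> s) (t \<otimes> k \<otimes> inv t) = busemann_seq \<alpha> s k"
  using assms by (simp add: busemann_seq_def act_mult)

end

text \<open>The subgroup is a parameter because, for a lineal action, one and the same \<open>H\<close> is used at both
  limit points.\<close>

locale boundary_point_stabilizer = isometric_group_action G \<alpha>
  for G :: "('g, 'm) monoid_scheme" (structure)
    and \<alpha> :: "'g \<Rightarrow> 'x \<Rightarrow> 'x::metric_space" +
  fixes H :: "'g set" and \<xi> :: "(nat \<Rightarrow> 'x) set"
  assumes subgroup: "subgroup H G"
    and boundary_point: "\<xi> \<in> gromov_boundary"
    and fixes_point: "\<And>h. h \<in> H \<Longrightarrow> boundary_action \<alpha> h \<xi> = \<xi>"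
begin

abbreviation "K \<equiv> G\<lparr>carrier := H\<rparr>"
abbreviation "\<beta> \<equiv> busemann K \<alpha> \<xi>"

lemma group_K: "group K"
  using subgroup by (rule subgroup_imp_group)

lemma mem_G [simp]: "h \<in> H \<Longrightarrow> h \<in> carrier G"
  using subgroup by (rule subgroup.mem_carrier)

lemma same_point: "s \<in> \<xi> \<Longrightarrow> t \<in> \<xi> \<Longrightarrow> (s, t) \<in> boundary_rel"
  using in_quotient_imp_in_rel[OF equiv_boundary_rel[OF hyp]] boundary_point
  unfolding gromov_boundary_def by blast

lemma ex_sequence: "\<exists>s. s \<in> \<xi>"
  using in_quotient_imp_non_empty[OF equiv_boundary_rel[OF hyp]] boundary_point
  unfolding gromov_boundary_def by blast

lemma translate_mem: "h \<in> H \<Longrightarrow> s \<in> \<xi> \<Longrightarrow> \<alpha> h \<circ> s \<in> \<xi>"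
  using fixes_point[of h] unfolding boundary_action_def by blast

lemma translate_inv_mem: "h \<in> H \<Longrightarrow> s \<in> \<xi> \<Longrightarrow> \<alpha> (inv h) \<circ> s \<in> \<xi>"
  using translate_mem subgroup.m_inv_closed[OF subgroup] by blast

lemma busemann_seq_bounded_defect:
  obtains D where "\<And>s g h. s \<in> \<xi> \<Longrightarrow> g \<in> carrier K \<Longrightarrow> h \<in> carrier K \<Longrightarrow>
    \<bar>busemann_seq \<alpha> s (g \<otimes>\<^bsub>K\<^esub> h) - busemann_seq \<alpha> s g - busemann_seq \<alpha> s h\<bar> \<le> D"
proof -
  obtain D where D: "\<And>s g h. (s, \<alpha> (inv g) \<circ> s) \<in> boundary_rel \<Longrightarrow>
    g \<in> carrier G \<Longrightarrow> h \<in> carrier G \<Longrightarrow>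
    \<bar>busemann_seq \<alpha> s (g \<otimes> h) - busemann_seq \<alpha> s g - busemann_seq \<alpha> s h\<bar> \<le> D"
    using busemann_seq_quasimorphism by blast
  show ?thesis
    by (rule that[of D]) (use D same_point translate_inv_mem in simp)
qed

lemma homogenization_busemann_seq:
  assumes "s \<in> \<xi>" "k \<in> H"
  shows "(\<lambda>n::nat. busemann_seq \<alpha> s (k [^] n) / real n)
    \<longlonglongrightarrow> homogenization K (busemann_seq \<alpha> s) k"
proof -
  obtain D where D: "\<And>s g h. s \<in> \<xi> \<Longrightarrow> g \<in> carrier K \<Longrightarrow> h \<in> carrier K \<Longrightarrow>
    \<bar>busemann_seq \<alpha> s (g \<otimes>\<^bsub>K\<^esub> h) - busemann_seq \<alpha> s g - busemann_seq \<alpha> s h\<bar> \<le> D"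
    using busemann_seq_bounded_defect by blast
  show ?thesis
    unfolding nat_pow_consistent[of _ _ H]
    by (rule homogenization_tendsto(1)[OF group_K]) (use assms(2) D[OF assms(1)] in auto)
qed

lemma pow_closed: "k \<in> H \<Longrightarrow> k [^] (n::nat) \<in> H"
  using monoid.nat_pow_closed[OF group.is_monoid[OF group_K], of k n]
  by (simp flip: nat_pow_consistent)

text \<open>Independence of the sequence is what makes the definite description in \<open>busemann\<close> meaningful.\<close>

lemma busemann_eq_homogenization:
  assumes s: "s \<in> \<xi>" and k: "k \<in> H"
  shows "\<beta> k = homogenization K (busemann_seq \<alpha> s) k"
proof -
  have same: "homogenization K (busemann_seq \<alpha> t) k = homogenization K (busemann_seq \<alpha> s) k"
    if t: "t \<in> \<xi>" for t
  proof -
    obtain C where C: "\<And>g. g \<in> carrier G \<Longrightarrow> \<bar>busemann_seq \<alpha> t g - busemann_seq \<alpha> s g\<bar> \<le> C"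
      using busemann_seq_change_sequence[OF same_point[OF t s]] by blast
    have "(\<lambda>n::nat. busemann_seq \<alpha> s (k [^] n) / real n)
        \<longlonglongrightarrow> homogenization K (busemann_seq \<alpha> t) k"
      by (rule bounded_difference_same_rate[where C = C, OF homogenization_busemann_seq[OF t k]])
         (use C k in simp)
    then show ?thesis
      using homogenization_busemann_seq[OF s k] LIMSEQ_unique by blast
  qed
  show ?thesis
    unfolding busemann_def by (rule the_equality, use same in blast, metis s)
qed

lemma busemann_tendsto:
  assumes "s \<in> \<xi>" "k \<in> H"
  shows "(\<lambda>n::nat. busemann_seq \<alpha> s (k [^] n) / real n) \<longlonglongrightarrow> \<beta> k"
  using homogenization_busemann_seq[OF assms] busemann_eq_homogenization[OF assms] by simp

lemma busemann_bounded_defect: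
  obtains D where "\<And>g h. g \<in> H \<Longrightarrow> h \<in> H \<Longrightarrow> \<bar>\<beta> (g \<otimes> h) - \<beta> g - \<beta> h\<bar> \<le> D"
proof -
  obtain s where s: "s \<in> \<xi>" using ex_sequence by blast
  obtain D where D: "\<And>s g h. s \<in> \<xi> \<Longrightarrow> g \<in> carrier K \<Longrightarrow> h \<in> carrier K \<Longrightarrow>
    \<bar>busemann_seq \<alpha> s (g \<otimes>\<^bsub>K\<^esub> h) - busemann_seq \<alpha> s g - busemann_seq \<alpha> s h\<bar> \<le> D"
    using busemann_seq_bounded_defect by blast
  have near: "\<bar>\<beta> g - busemann_seq \<alpha> s g\<bar> \<le> D" if "g \<in> H" for g
    unfolding busemann_eq_homogenization[OF s that]
    by (rule homogenization_tendsto(2)[OF group_K]) (use that D[OF s] in auto)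
  have "\<bar>\<beta> (g \<otimes> h) - \<beta> g - \<beta> h\<bar> \<le> 4 * D" if "g \<in> H" "h \<in> H" for g h
    using near[of g] near[of h] near[of "g \<otimes> h"] D[OF s, of g h] that
      subgroup.m_closed[OF subgroup] by simp
  then show ?thesis using that by blast
qed

end

text \<open>With \<open>u\<close> the translate of \<open>s\<close> by \<open>t\<close>, the values at \<open>k\<close> along \<open>s\<close> and at \<open>t k t\<inverse>\<close> along \<open>u\<close> are equal,
  while the values at \<open>t k t\<inverse>\<close> along \<open>u\<close> and along \<open>s\<close> are opposite up to a constant. Applying this
  to all powers of \<open>k\<close> and dividing by the exponent removes the constant.\<close>

lemma (in boundary_point_stabilizer) busemann_conjugate_swap:
  assumes stab: "boundary_point_stabilizer G \<alpha> H \<eta>" and ne: "\<xi> \<noteq> \<eta>"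
    and t: "t \<in> carrier G" "boundary_action \<alpha> t \<xi> = \<eta>"
    and k: "k \<in> H" "t \<otimes> k \<otimes> inv t \<in> H"
  shows "\<beta> (t \<otimes> k \<otimes> inv t) = - \<beta> k"
proof -
  interpret opposite: boundary_point_stabilizer G \<alpha> H \<eta> by fact
  obtain s where s: "s \<in> \<xi>" using ex_sequence by blast
  define u where "u = \<alpha> t \<circ> s"
  have u: "u \<in> \<eta>" using s t(2) by (auto simp: u_def boundary_action_def)
  have conv: "converges_to_infinity s" "converges_to_infinity u"
    using same_point[OF s s] opposite.same_point[OF u u] by (simp_all add: boundary_rel_def)
  have "(s, u) \<notin> boundary_rel"
    using quotient_eqI[OF equiv_boundary_rel[OF hyp] _ _ s u] ne boundary_point
      opposite.boundary_point
    by (auto simp: gromov_boundary_def)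
  then obtain C where C: "\<And>g. g \<in> carrier G \<Longrightarrow>
    (\<alpha> (inv g) \<circ> s, s) \<in> boundary_rel \<Longrightarrow> (u, \<alpha> (inv g) \<circ> u) \<in> boundary_rel \<Longrightarrow>
    \<bar>busemann_seq \<alpha> s g + busemann_seq \<alpha> u g\<bar> \<le> C"
    using busemann_seq_opposite_ends[OF conv] by blast
  have opp: "\<bar>busemann_seq \<alpha> s g + busemann_seq \<alpha> u g\<bar> \<le> C" if "g \<in> H" for g
    using C[of g] that s u same_point opposite.same_point translate_inv_mem
      opposite.translate_inv_mem by simp
  let ?k' = "t \<otimes> k \<otimes> inv t"
  have "busemann_seq \<alpha> u (?k' [^] n) = busemann_seq \<alpha> s (k [^] n)" for n :: nat
    using t(1) k(1) by (simp add: u_def conj_pow busemann_seq_conjugate)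
  then have "\<bar>busemann_seq \<alpha> s (?k' [^] n) - (- busemann_seq \<alpha> s (k [^] n))\<bar> \<le> C" for n :: nat
    using opp[OF pow_closed[OF k(2)], of n] by simp
  from bounded_difference_same_rate[OF busemann_tendsto[OF s k(2)] this]
  have "(\<lambda>n::nat. - (busemann_seq \<alpha> s (k [^] n) / real n)) \<longlonglongrightarrow> \<beta> ?k'"
    by simp
  moreover have "(\<lambda>n::nat. - (busemann_seq \<alpha> s (k [^] n) / real n)) \<longlonglongrightarrow> - \<beta> k"
    by (rule tendsto_minus[OF busemann_tendsto[OF s k(1)]])
  ultimately show ?thesis by (rule LIMSEQ_unique)
qed

section \<open>Extending an anti-invariant quasimorphism\<close>

lemma sign_img_hom_values:
  assumes "\<epsilon> \<in> hom G sign_img" "g \<in> carrier G"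
  shows "\<epsilon> g = 1 \<or> \<epsilon> g = - 1"
  using assms by (auto simp: hom_def sign_img_def Pi_iff)

text \<open>Every element outside the kernel is \<open>k t\<close> for a unique \<open>k\<close> in the kernel. A cocycle \<open>\<phi>\<close> extending
  \<open>\<beta>\<close> would satisfy \<open>\<phi> (k t) = \<beta> k + \<phi> t\<close>; the value at \<open>t\<close> is taken to be 0. In a product, \<open>t\<close> has to be
  moved to the right past a kernel element \<open>l\<close>; this replaces \<open>l\<close> by its conjugate, and
  anti-invariance supplies exactly the sign in the cocycle identity. When both factors lie outside
  the kernel a factor \<open>t\<^sup>2\<close> remains, at the cost of a second application of the quasimorphism
  inequality.\<close>

lemma anti_invariant_extension:
  fixes \<beta> :: "'g \<Rightarrow> real" and \<epsilon> :: "'g \<Rightarrow> int"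
  assumes "group G" and \<epsilon>: "\<epsilon> \<in> hom G sign_img"
    and t: "t \<in> carrier G" "\<epsilon> t = - 1"
    and D: "\<And>g h. g \<in> kernel G sign_img \<epsilon> \<Longrightarrow> h \<in> kernel G sign_img \<epsilon> \<Longrightarrow>
      \<bar>\<beta> (g \<otimes>\<^bsub>G\<^esub> h) - \<beta> g - \<beta> h\<bar> \<le> D"
    and anti: "\<And>k. k \<in> kernel G sign_img \<epsilon> \<Longrightarrow> \<beta> (t \<otimes>\<^bsub>G\<^esub> k \<otimes>\<^bsub>G\<^esub> inv\<^bsub>G\<^esub> t) = - \<beta> k"
  obtains \<phi> :: "'g \<Rightarrow> real" where "\<And>k. k \<in> kernel G sign_img \<epsilon> \<Longrightarrow> \<phi> k = \<beta> k"
    and "\<And>g h. g \<in> carrier G \<Longrightarrow> h \<in> carrier G \<Longrightarrow>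
      \<bar>\<phi> (g \<otimes>\<^bsub>G\<^esub> h) - \<phi> g - of_int (\<epsilon> g) * \<phi> h\<bar> \<le> 2 * D"
proof -
  interpret group G by fact
  let ?N = "kernel G sign_img \<epsilon>"
  have mult: "\<epsilon> (g \<otimes>\<^bsub>G\<^esub> h) = \<epsilon> g * \<epsilon> h" if "g \<in> carrier G" "h \<in> carrier G" for g h
    using hom_mult[OF \<epsilon> that] by (simp add: sign_img_def)
  have N: "k \<in> ?N \<longleftrightarrow> k \<in> carrier G \<and> \<epsilon> k = 1" for k
    by (auto simp: kernel_def sign_img_def)
  have inv_t: "\<epsilon> (inv\<^bsub>G\<^esub> t) = - 1"
  proof -
    have "\<epsilon> \<one>\<^bsub>G\<^esub> = 1"
      using mult[of "\<one>\<^bsub>G\<^esub>" "\<one>\<^bsub>G\<^esub>"] sign_img_hom_values[OF \<epsilon>, of "\<one>\<^bsub>G\<^esub>"] by auto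
    then show ?thesis using mult[of t "inv\<^bsub>G\<^esub> t"] t by auto
  qed
  define \<phi> where "\<phi> g = (if \<epsilon> g = 1 then \<beta> g else \<beta> (g \<otimes>\<^bsub>G\<^esub> inv\<^bsub>G\<^esub> t))" for g
  have \<phi>_N: "\<phi> k = \<beta> k" if "k \<in> ?N" for k using that by (simp add: \<phi>_def N)
  have \<phi>_coset: "\<phi> (k \<otimes>\<^bsub>G\<^esub> t) = \<beta> k" if "k \<in> ?N" for k
    using that t mult[of k t] by (simp add: \<phi>_def N m_assoc)
  have \<epsilon>_coset: "\<epsilon> (k \<otimes>\<^bsub>G\<^esub> t) = - 1" if "k \<in> ?N" for k
    using that t mult[of k t] by (simp add: N)
  have N_mult: "g \<otimes>\<^bsub>G\<^esub> h \<in> ?N" if "g \<in> ?N" "h \<in> ?N" for g h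
    using that mult by (simp add: N)
  have N_conj: "t \<otimes>\<^bsub>G\<^esub> k \<otimes>\<^bsub>G\<^esub> inv\<^bsub>G\<^esub> t \<in> ?N" if "k \<in> ?N" for k
    using that t mult inv_t by (simp add: N)
  have N_tt: "t \<otimes>\<^bsub>G\<^esub> t \<in> ?N" using t mult by (simp add: N)
  have "t \<otimes>\<^bsub>G\<^esub> (t \<otimes>\<^bsub>G\<^esub> t) \<otimes>\<^bsub>G\<^esub> inv\<^bsub>G\<^esub> t = t \<otimes>\<^bsub>G\<^esub> t"
    using t by (simp add: m_assoc)
  (* Conjugation by t fixes the square of t, so its value equals its own negative. *)
  then have \<beta>_tt: "\<beta> (t \<otimes>\<^bsub>G\<^esub> t) = 0" using anti[OF N_tt] by simp
  have cases: "g \<in> ?N \<or> (\<exists>k\<in>?N. g = k \<otimes>\<^bsub>G\<^esub> t)" if "g \<in> carrier G" for g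
  proof (cases "\<epsilon> g = 1")
    case False
    then have "\<epsilon> g = - 1" using sign_img_hom_values[OF \<epsilon> that] by blast
    then have "g \<otimes>\<^bsub>G\<^esub> inv\<^bsub>G\<^esub> t \<in> ?N" "g = (g \<otimes>\<^bsub>G\<^esub> inv\<^bsub>G\<^esub> t) \<otimes>\<^bsub>G\<^esub> t"
      using that t mult inv_t by (simp_all add: N m_assoc)
    then show ?thesis by blast
  qed (use that N in auto)
  have D0: "0 \<le> D" using D[OF N_tt N_tt] by linarith
  have main: "\<bar>\<phi> (g \<otimes>\<^bsub>G\<^esub> h) - \<phi> g - of_int (\<epsilon> g) * \<phi> h\<bar> \<le> 2 * D"
    if g: "g \<in> carrier G" and h: "h \<in> carrier G" for g h
    using cases[OF g] cases[OF h]
  proof (elim disjE bexE)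
    assume "g \<in> ?N" "h \<in> ?N"
    then show ?thesis using D[of g h] D0 \<phi>_N N_mult N by auto
  next
    fix k assume gN: "g \<in> ?N" and k: "k \<in> ?N" "h = k \<otimes>\<^bsub>G\<^esub> t"
    have "g \<otimes>\<^bsub>G\<^esub> h = (g \<otimes>\<^bsub>G\<^esub> k) \<otimes>\<^bsub>G\<^esub> t"
      using gN k t by (simp add: N m_assoc)
    then have "\<phi> (g \<otimes>\<^bsub>G\<^esub> h) = \<beta> (g \<otimes>\<^bsub>G\<^esub> k)"
      using \<phi>_coset[OF N_mult[OF gN k(1)]] by simp
    then show ?thesis
      using D[OF gN k(1)] D0 \<phi>_N[OF gN] \<phi>_coset[OF k(1)] k(2) gN by (simp add: N)
  next
    fix k assume k: "k \<in> ?N" "g = k \<otimes>\<^bsub>G\<^esub> t" and hN: "h \<in> ?N"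
    let ?h = "t \<otimes>\<^bsub>G\<^esub> h \<otimes>\<^bsub>G\<^esub> inv\<^bsub>G\<^esub> t"
    have "g \<otimes>\<^bsub>G\<^esub> h = (k \<otimes>\<^bsub>G\<^esub> ?h) \<otimes>\<^bsub>G\<^esub> t"
      using hN k t by (simp add: N m_assoc)
    then have "\<phi> (g \<otimes>\<^bsub>G\<^esub> h) = \<beta> (k \<otimes>\<^bsub>G\<^esub> ?h)"
      using \<phi>_coset[OF N_mult[OF k(1) N_conj[OF hN]]] by simp
    then show ?thesis
      using D[OF k(1) N_conj[OF hN]] D0 anti[OF hN] \<phi>_N[OF hN] \<phi>_coset[OF k(1)]
        \<epsilon>_coset[OF k(1)] k(2) by simp
  next
    fix k l assume k: "k \<in> ?N" "g = k \<otimes>\<^bsub>G\<^esub> t" and l: "l \<in> ?N" "h = l \<otimes>\<^bsub>G\<^esub> t"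
    let ?l = "t \<otimes>\<^bsub>G\<^esub> l \<otimes>\<^bsub>G\<^esub> inv\<^bsub>G\<^esub> t"
    have "g \<otimes>\<^bsub>G\<^esub> h = (k \<otimes>\<^bsub>G\<^esub> ?l) \<otimes>\<^bsub>G\<^esub> (t \<otimes>\<^bsub>G\<^esub> t)"
      using l k t by (simp add: N m_assoc inv_mult_cancel)
    moreover note kl = N_mult[OF k(1) N_conj[OF l(1)]]
    ultimately have "\<phi> (g \<otimes>\<^bsub>G\<^esub> h) = \<beta> ((k \<otimes>\<^bsub>G\<^esub> ?l) \<otimes>\<^bsub>G\<^esub> (t \<otimes>\<^bsub>G\<^esub> t))"
      using \<phi>_N[OF N_mult[OF kl N_tt]] by simp
    then show ?thesis
      using D[OF kl N_tt] D[OF k(1) N_conj[OF l(1)]] anti[OF l(1)] \<beta>_tt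
        \<phi>_coset[OF k(1)] \<phi>_coset[OF l(1)] \<epsilon>_coset[OF k(1)] k(2) l(2) by simp
  qed
  show ?thesis by (rule that[OF \<phi>_N main])
qed

section \<open>The quasicocycle of a non-orientable lineal action\<close>

text \<open>The inequality has to be used with the defect itself in place of an arbitrary bound: only then
  does the extension satisfy the sharp estimate by twice the defect.\<close>

lemma bounded_defect:
  assumes "group K"
    and D: "\<And>g h. g \<in> carrier K \<Longrightarrow> h \<in> carrier K \<Longrightarrow> \<bar>q (g \<otimes>\<^bsub>K\<^esub> h) - q g - q h\<bar> \<le> D"
  obtains d where "defect K q = ereal d" and "\<And>g h. g \<in> carrier K \<Longrightarrow> h \<in> carrier K \<Longrightarrow>
    \<bar>q (g \<otimes>\<^bsub>K\<^esub> h) - q g - q h\<bar> \<le> d"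
proof -
  interpret group K by fact
  have upper: "defect K q \<le> ereal D"
    unfolding defect_def by (rule SUP_least) (use D in auto)
  have lower: "ereal \<bar>q (g \<otimes>\<^bsub>K\<^esub> h) - q g - q h\<bar> \<le> defect K q"
    if "g \<in> carrier K" "h \<in> carrier K" for g h
    unfolding defect_def by (rule SUP_upper2[of "(g, h)"]) (use that in auto)
  have "defect K q = ereal (real_of_ereal (defect K q))"
    using upper lower[OF one_closed one_closed] by (cases "defect K q") auto
  with lower that show ?thesis by (metis ereal_less_eq(3))
qed

theorem proposition2p10:
  fixes G :: "('g, 'm) monoid_scheme"
    and \<alpha> :: "'g \<Rightarrow> 'x \<Rightarrow> 'x::metric_space"
    and \<xi>\<^sub>p \<xi>\<^sub>m :: "(nat \<Rightarrow> 'x) set"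
    and \<epsilon> :: "'g \<Rightarrow> int"
    and K :: "('g, 'm) monoid_scheme"
  assumes "hyperbolic_space TYPE('x)"
    and "nonorientable_lineal_action G \<alpha>"
    and "limit_set G \<alpha> = {\<xi>\<^sub>p, \<xi>\<^sub>m}"
    and "\<epsilon> = (\<lambda>g. if swaps \<alpha> g \<xi>\<^sub>p \<xi>\<^sub>m then - 1 else 1)"
    and "K = G\<lparr>carrier := kernel G sign_img \<epsilon>\<rparr>"
  shows "\<exists>\<phi> :: 'g \<Rightarrow> real.
      quasicocycle G \<epsilon> \<phi> \<and>
      (\<forall>k\<in>carrier K. \<phi> k = busemann K \<alpha> \<xi>\<^sub>p k) \<and>
      cocycle_defect G \<epsilon> \<phi> \<le> 2 * defect K (busemann K \<alpha> \<xi>\<^sub>p) \<and>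
      (cocycle G \<epsilon> \<phi> \<longleftrightarrow> regular_action K \<alpha> \<xi>\<^sub>p)"
proof -
  have "isometric_action G \<alpha>"
    using assms(2) by (simp add: nonorientable_lineal_action_def lineal_action_def)
  then interpret isometric_group_action G \<alpha>
    using assms(1) by unfold_locales (auto simp: hyperbolic_space_def)
  have ne: "\<xi>\<^sub>p \<noteq> \<xi>\<^sub>m"
    using assms(2,3) by (auto simp: nonorientable_lineal_action_def lineal_action_def)
  have permutes: "boundary_action \<alpha> g \<xi>\<^sub>p \<in> {\<xi>\<^sub>p, \<xi>\<^sub>m}" "boundary_action \<alpha> g \<xi>\<^sub>m \<in> {\<xi>\<^sub>p, \<xi>\<^sub>m}"
    if "g \<in> carrier G" for g
    using boundary_action_limit_set[OF that] assms(3) by simp_all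
  have distinct: "boundary_action \<alpha> g \<xi>\<^sub>p \<noteq> boundary_action \<alpha> g \<xi>\<^sub>m" if "g \<in> carrier G" for g
    using boundary_action_inv[OF that] ne by metis
  (* Elements of the group permute the two limit points, so not swapping them means fixing both. *)
  have fix_or_swap: "\<epsilon> g = 1 \<and> boundary_action \<alpha> g \<xi>\<^sub>p = \<xi>\<^sub>p \<and> boundary_action \<alpha> g \<xi>\<^sub>m = \<xi>\<^sub>m \<or>
      \<epsilon> g = - 1 \<and> boundary_action \<alpha> g \<xi>\<^sub>p = \<xi>\<^sub>m \<and> boundary_action \<alpha> g \<xi>\<^sub>m = \<xi>\<^sub>p"
    if "g \<in> carrier G" for g
    using permutes[OF that] distinct[OF that] ne by (auto simp: assms(4) swaps_def)
  have hom: "\<epsilon> \<in> hom G sign_img"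
  proof (rule homI)
    fix g h assume g: "g \<in> carrier G" and h: "h \<in> carrier G"
    then show "\<epsilon> (g \<otimes>\<^bsub>G\<^esub> h) = \<epsilon> g \<otimes>\<^bsub>sign_img\<^esub> \<epsilon> h"
      using fix_or_swap[OF g] fix_or_swap[OF h] fix_or_swap[of "g \<otimes>\<^bsub>G\<^esub> h"]
        boundary_action_mult[OF g h] ne by (auto simp: sign_img_def)
  qed (use fix_or_swap in \<open>auto simp: sign_img_def\<close>)
  let ?N = "kernel G sign_img \<epsilon>" and ?\<beta> = "busemann K \<alpha> \<xi>\<^sub>p"
  have N: "k \<in> ?N \<longleftrightarrow> k \<in> carrier G \<and> \<epsilon> k = 1" for k
    by (auto simp: kernel_def sign_img_def)
  interpret \<epsilon>: group_hom G sign_img \<epsilon>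
    by (intro group_hom.intro group_hom_axioms.intro group_axioms sign_img_is_group hom)
  have stab: "boundary_point_stabilizer G \<alpha> ?N \<xi>" if "\<xi> \<in> {\<xi>\<^sub>p, \<xi>\<^sub>m}" for \<xi>
  proof (intro boundary_point_stabilizer.intro boundary_point_stabilizer_axioms.intro)
    show "isometric_group_action G \<alpha>" by (rule isometric_group_action_axioms)
    show "subgroup ?N G" by (rule \<epsilon>.subgroup_kernel)
    show "\<xi> \<in> gromov_boundary"
      using that unfolding assms(3)[symmetric] limit_set_def accumulation_points_def by blast
    show "boundary_action \<alpha> h \<xi> = \<xi>" if "h \<in> ?N" for h
      using fix_or_swap[of h] that \<open>\<xi> \<in> {\<xi>\<^sub>p, \<xi>\<^sub>m}\<close> by (auto simp: N)
  qed
  interpret P: boundary_point_stabilizer G \<alpha> ?N \<xi>\<^sub>p by (rule stab) simp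
  have K: "K = G\<lparr>carrier := ?N\<rparr>" "carrier K = ?N" "\<And>g h. g \<otimes>\<^bsub>K\<^esub> h = g \<otimes>\<^bsub>G\<^esub> h"
    using assms(5) by simp_all
  have "group K" using P.group_K K(1) by simp
  obtain D where D: "\<And>g h. g \<in> ?N \<Longrightarrow> h \<in> ?N \<Longrightarrow> \<bar>?\<beta> (g \<otimes>\<^bsub>G\<^esub> h) - ?\<beta> g - ?\<beta> h\<bar> \<le> D"
    using P.busemann_bounded_defect unfolding K(1)[symmetric] by blast
  obtain d where d: "defect K ?\<beta> = ereal d"
      and dK: "\<And>g h. g \<in> ?N \<Longrightarrow> h \<in> ?N \<Longrightarrow> \<bar>?\<beta> (g \<otimes>\<^bsub>G\<^esub> h) - ?\<beta> g - ?\<beta> h\<bar> \<le> d"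
    using bounded_defect[OF \<open>group K\<close>, of ?\<beta> D] D unfolding K(2,3) by metis
  obtain t where t: "t \<in> carrier G" "\<epsilon> t = - 1"
  proof -
    obtain t \<xi> \<eta> where "t \<in> carrier G" "\<xi> \<in> {\<xi>\<^sub>p, \<xi>\<^sub>m}" "\<eta> \<in> {\<xi>\<^sub>p, \<xi>\<^sub>m}" "\<xi> \<noteq> \<eta>" "swaps \<alpha> t \<xi> \<eta>"
      using assms(2,3) by (auto simp: nonorientable_lineal_action_def orientable_lineal_action_def)
    then have "swaps \<alpha> t \<xi>\<^sub>p \<xi>\<^sub>m" unfolding swaps_def by blast
    then show ?thesis using that[of t] \<open>t \<in> carrier G\<close> by (simp add: assms(4))
  qed
  have anti: "?\<beta> (t \<otimes>\<^bsub>G\<^esub> k \<otimes>\<^bsub>G\<^esub> inv\<^bsub>G\<^esub> t) = - ?\<beta> k" if "k \<in> ?N" for k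
  proof -
    have "t \<otimes>\<^bsub>G\<^esub> k \<otimes>\<^bsub>G\<^esub> inv\<^bsub>G\<^esub> t \<in> ?N"
      using normal.inv_op_closed2[OF \<epsilon>.normal_kernel t(1) that] .
    moreover have "boundary_action \<alpha> t \<xi>\<^sub>p = \<xi>\<^sub>m"
      using fix_or_swap[OF t(1)] t(2) by simp
    ultimately show ?thesis
      using P.busemann_conjugate_swap[OF stab[of \<xi>\<^sub>m] ne t(1) _ that]
      unfolding K(1)[symmetric] by blast
  qed
  obtain \<phi> where \<phi>: "\<And>k. k \<in> ?N \<Longrightarrow> \<phi> k = ?\<beta> k"
      and \<phi>_d: "\<And>g h. g \<in> carrier G \<Longrightarrow> h \<in> carrier G \<Longrightarrow>
        \<bar>\<phi> (g \<otimes>\<^bsub>G\<^esub> h) - \<phi> g - of_int (\<epsilon> g) * \<phi> h\<bar> \<le> 2 * d"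
    using anti_invariant_extension[where \<beta> = ?\<beta> and D = d, OF group_axioms hom t dK anti] by blast
  have upper: "cocycle_defect G \<epsilon> \<phi> \<le> ereal (2 * d)"
    unfolding cocycle_defect_def by (rule SUP_least) (use \<phi>_d in auto)
  have lower: "ereal \<bar>\<phi> (g \<otimes>\<^bsub>G\<^esub> h) - \<phi> g - of_int (\<epsilon> g) * \<phi> h\<bar> \<le> cocycle_defect G \<epsilon> \<phi>"
    if "g \<in> carrier G" "h \<in> carrier G" for g h
    unfolding cocycle_defect_def by (rule SUP_upper2[of "(g, h)"]) (use that in auto)
  have quasi: "quasicocycle G \<epsilon> \<phi>"
    unfolding quasicocycle_def using hom upper by (auto intro: le_less_trans)
  have "cocycle G \<epsilon> \<phi> \<longleftrightarrow> regular_action K \<alpha> \<xi>\<^sub>p"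
  proof
    assume "cocycle G \<epsilon> \<phi>"
    then have zero: "\<phi> (g \<otimes>\<^bsub>G\<^esub> h) = \<phi> g + of_int (\<epsilon> g) * \<phi> h"
      if "g \<in> carrier G" "h \<in> carrier G" for g h
      using lower[OF that] by (simp add: cocycle_def zero_ereal_def)
    show "regular_action K \<alpha> \<xi>\<^sub>p"
      unfolding regular_action_def K(2,3)
    proof (intro ballI)
      fix g h assume g: "g \<in> ?N" and h: "h \<in> ?N"
      then show "?\<beta> (g \<otimes>\<^bsub>G\<^esub> h) = ?\<beta> g + ?\<beta> h"
        using zero[of g h] \<phi>[OF g] \<phi>[OF h] \<phi>[of "g \<otimes>\<^bsub>G\<^esub> h"] subgroup.m_closed[OF P.subgroup g h]
        by (simp add: N)
    qed
  next
    assume "regular_action K \<alpha> \<xi>\<^sub>p"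
    then have "defect K ?\<beta> \<le> 0"
      unfolding regular_action_def defect_def
      by (intro SUP_least) (auto simp: zero_ereal_def)
    then have "cocycle_defect G \<epsilon> \<phi> \<le> 0"
      using upper d by (metis ereal_less_eq(3) mult_2 add_nonpos_nonpos order_trans zero_ereal_def)
    moreover have "0 \<le> cocycle_defect G \<epsilon> \<phi>"
      using lower[OF one_closed one_closed] by (meson abs_ge_zero ereal_less_eq(5) order_trans)
    ultimately show "cocycle G \<epsilon> \<phi>" using quasi by (simp add: cocycle_def)
  qed
  moreover have "cocycle_defect G \<epsilon> \<phi> \<le> 2 * defect K ?\<beta>"
    using upper d by simp
  ultimately show ?thesis using quasi \<phi> K(2) by auto
qed

end
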